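(* Let $g\ge 1$ and $n\ge 1$ be integers with $k:=2-2g+n>0$, and let $W^g_{k}(p,p_1,\dots,p_{k-1})$ be the genus-$g$ solution of the topological recursion of Euler characteristic $-n=2-2g-k$, with graphical representation $\psi(W^g_k)$. Then $\psi(W^g_k)$ is given by the $n$-fold product $\mathbf{(1)}\ast\mathbf{(1)}\ast\cdots\ast\mathbf{(1)}$, followed by the identification of pairs of nearest neighbor leaves in all possible ways producing graphs with $g$ loops (each different graph taken once), and finally by summing over all permutations of the labels $p_1,\dots,p_{1-2g+n}$ of the free leaves: $$\psi\big(W^g_{k}(p,p_1,\dots,p_{k-1})\big)=\sum_{\text{perm. of }\{p_1,\dots,p_{k-1}\}}C_g\big(\underbrace{\mathbf{(1)}\ast\mathbf{(1)}\ast\cdots\ast\mathbf{(1)}}_{n}\big),$$ where $C_g$ is the linear map sending a tree $t$ to the sum of all different $g$-loop graphs obtained from $t$.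
   Context: Planar binary trees. A planar binary tree is a rooted planar tree all of whose internal vertices are trivalent (one edge down, an ordered left and right edge up). Its order $|t|$ is the number of internal vertices; a tree of order $n$ has $n+1$ leaves, numbered $0,\dots,n$ from left to right. $Y^n$ is the set of planar binary trees of order $n$; $Y^0=\{|\}$, where $|$ is the tree with a single edge and no vertex. The grafting $t_1\vee t_2$ is the tree with left branch $t_1$ and right branch $t_2$ at the root vertex; every tree of order $n\ge1$ is uniquely $t_1\vee t_2$ with $|t_1|+|t_2|+1=n$. Put $\mathbf{(1)}=|\vee|$. On the $\mathbb{Q}$-vector space with basis all planar binary trees, the associative bilinear Loday--Ronco product $\ast$ is determined by $t\ast|=|\ast t=t$ and, for $t=t_1\vee t_2$, $t'=t_1'\vee t_2'$, $t\ast t'=t_1\vee(t_2\ast t')+(t\ast t_1')\vee t_2'$ ($\vee$ extended bilinearly). Graphs with loops. For a planar binary tree, the operation ${}_i\leftrightarrow_{i+1}$ connects the two nearest neighbor leaves $i$ and $i+1$ by an edge, producing a loop; the connected leaves are no longer free and carry no label, and the operation may be applied again to other neighboring pairs $(j,j+1)$ of leaves of the original tree that are both still free (it gives $0$ otherwise). A $g$-loop graph obtained from $t\in Y^n$ is thus the tree $t$ together with a set of $g$ pairwise disjoint pairs $\{i,i+1\}$, $0\le i\le n-1$, of adjacent leaves; it has $n+1-2g$ free leaves. $(Y^n)^g$ is the set of all such graphs for $t\in Y^n$; two of them are different if the underlying trees are different or if the sets of connected pairs are different. $(Y^n)^0=Y^n$. The root is labeled $p$. Representation $\psi$. The correlation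 functions $W^g_k(p,p_1,\dots,p_{k-1})$ are those determined from $W^0_2$ by the Eynard--Orantin recursion $W_{k+1}^g(p,K)=K_p(q,\bar q)\big(W^{g-1}_{k+2}(q,\bar q,K)+\sum_{h=0}^g\sum_{L\sqcup M=K}W^h_{|L|+1}(q,L)W^{g-h}_{|M|+1}(\bar q,M)\big)$, where $K_p(q,\bar q)$ is the recursion kernel (sum of residues at branch points understood), $K=\{p_1,\dots,p_k\}$, and only factors of Euler characteristic $\le 0$ occur. For $n=-\chi=2g-2+k$, the representation $\psi(W^g_k(p,p_1,\dots,p_{k-1}))$ is by definition the formal sum of all different graphs $t^g\in(Y^n)^g$, with all bijective labelings of their $k-1$ free leaves by $p_1,\dots,p_{k-1}$. "Sum over permutations of the labels" of a formal combination of graphs means that each graph is replaced by the sum of its $(k-1)!$ labeled versions. *)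

theory Defs
  imports Complex_Main "HOL-Library.FuncSet" "HOL-Library.Disjoint_Sets" "HOL-Library.Poly_Mapping"
begin

section \<open>Formal rational linear combinations\<close>

text \<open>The rational vector space with basis \<open>'a\<close> is the type of finitely supported functions
  from \<open>'a\<close> to the rationals.\<close>

type_synonym 'a comb = "'a \<Rightarrow>\<^sub>0 rat"

abbreviation basis :: "'a \<Rightarrow> 'a comb" where
  "basis a \<equiv> Poly_Mapping.single a 1"

definition scale :: "rat \<Rightarrow> 'a comb \<Rightarrow> 'a comb" where
  "scale c x = Poly_Mapping.map ((*) c) x"

definition lin_ext :: "('a \<Rightarrow> 'b comb) \<Rightarrow> 'a comb \<Rightarrow> 'b comb" where
  "lin_ext f x = (\<Sum>a\<in>Poly_Mapping.keys x. scale (Poly_Mapping.lookup x a) (f a))"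

lemma lin_ext_basis [simp]: "lin_ext f (basis a) = f a"
  by (rule poly_mapping_eqI)
    (simp add: lin_ext_def scale_def Poly_Mapping.map.rep_eq when_def)


section \<open>Planar binary trees and the Loday--Ronco product\<close>

datatype pbt = Edge | Graft pbt pbt  (infixr \<open>\<triangledown>\<close> 65)

fun order :: "pbt \<Rightarrow> nat" where
  "order Edge = 0"
| "order (l \<triangledown> r) = order l + order r + 1"

definition Y :: "nat \<Rightarrow> pbt set" where
  "Y n = {t. order t = n}"

definition corolla :: pbt where
  "corolla = Edge \<triangledown> Edge"

fun lr_tree :: "pbt \<Rightarrow> pbt \<Rightarrow> pbt comb" where
  "lr_tree t Edge = basis t"
| "lr_tree Edge t = basis t"
| "lr_tree (t1 \<triangledown> t2) (s1 \<triangledown> s2) =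
     lin_ext (\<lambda>u. basis (t1 \<triangledown> u)) (lr_tree t2 (s1 \<triangledown> s2)) +
     lin_ext (\<lambda>u. basis (u \<triangledown> s2)) (lr_tree (t1 \<triangledown> t2) s1)"

definition lr_prod :: "pbt comb \<Rightarrow> pbt comb \<Rightarrow> pbt comb"  (infixl \<open>\<star>\<close> 70) where
  "x \<star> y = lin_ext (\<lambda>s. lin_ext (\<lambda>t. lr_tree s t) y) x"

text \<open>The product is associative with unit \<open>basis Edge\<close>, so the bracketing chosen here for the
  \<open>n\<close>-fold product is immaterial.\<close>

primrec lr_power :: "pbt comb \<Rightarrow> nat \<Rightarrow> pbt comb" where
  "lr_power x 0 = basis Edge"
| "lr_power x (Suc n) = lr_power x n \<star> x"


section \<open>Graphs with loops\<close>

text \<open>A graph with loops is a tree together with the set of the pairs \<open>{i, i + 1}\<close> of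
  connected leaves, in the left-to-right numbering \<open>0, \<dots>, order t\<close> of the leaves of the tree.\<close>

type_synonym loop_graph = "pbt \<times> nat set set"

definition free_leaves :: "loop_graph \<Rightarrow> nat set" where
  "free_leaves G = {0..order (fst G)} - \<Union>(snd G)"

definition connect :: "nat \<Rightarrow> loop_graph \<Rightarrow> loop_graph comb" where
  "connect i G =
     (if {i, i + 1} \<subseteq> free_leaves G then basis (fst G, insert {i, i + 1} (snd G)) else 0)"

text \<open>\<open>loop_graphs_from g t\<close> is the set of graphs produced from \<open>t\<close> by \<open>g\<close> successive nonzero
  connections. Being a set, it contains a graph only once even though the \<open>g\<close> connections
  can be performed in any order.\<close>

primrec loop_graphs_from :: "nat \<Rightarrow> pbt \<Rightarrow> loop_graph set" where
  "loop_graphs_from 0 t = {(t, {})}"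
| "loop_graphs_from (Suc g) t =
     (\<Union>G\<in>loop_graphs_from g t. \<Union>i. Poly_Mapping.keys (connect i G))"

definition add_loops :: "nat \<Rightarrow> pbt comb \<Rightarrow> loop_graph comb" where
  "add_loops g = lin_ext (\<lambda>t. \<Sum>G\<in>loop_graphs_from g t. basis G)"

definition Y_loop :: "nat \<Rightarrow> nat \<Rightarrow> loop_graph set" where
  "Y_loop n g = {(t, P). t \<in> Y n \<and> P \<subseteq> {{i, i + 1} |i. i < n} \<and> disjoint P \<and> card P = g}"


section \<open>Labelings and the graphical representation of the correlation functions\<close>

text \<open>A labeled graph carries the label of its root and the labels of its free leaves; the
  labeling is \<open>undefined\<close> outside the free leaves, so that equal labelings are equal functions.\<close>

type_synonym 'p labeled_graph = "loop_graph \<times> 'p \<times> (nat \<Rightarrow> 'p)"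

definition labeled_versions :: "'p \<Rightarrow> 'p list \<Rightarrow> loop_graph \<Rightarrow> 'p labeled_graph set" where
  "labeled_versions p ps G =
     {(G, p, l) |l. l \<in> extensional (free_leaves G) \<and> bij_betw l (free_leaves G) (set ps)}"

definition sum_over_labels :: "'p \<Rightarrow> 'p list \<Rightarrow> loop_graph comb \<Rightarrow> 'p labeled_graph comb" where
  "sum_over_labels p ps = lin_ext (\<lambda>G. \<Sum>H\<in>labeled_versions p ps G. basis H)"

text \<open>The graphical representation is defined on the names of the correlation functions, not on
  their values: \<open>W g p [p\<^sub>1, \<dots>, p\<^sub>k\<^sub>-\<^sub>1]\<close> is the symbol of the genus \<open>g\<close> correlation function in
  the \<open>k\<close> arguments \<open>p, p\<^sub>1, \<dots>, p\<^sub>k\<^sub>-\<^sub>1\<close>. A representation depends on nothing else.\<close>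

datatype 'p correlation = W (genus: nat) (root_arg: 'p) (leaf_args: "'p list")

definition euler_char :: "'p correlation \<Rightarrow> int" where
  "euler_char w = 2 - 2 * int (genus w) - int (length (leaf_args w) + 1)"

text \<open>The conversion to \<open>nat\<close> is harmless: only \<open>g = 0\<close>, \<open>k = 1\<close> has positive Euler
  characteristic.\<close>

definition psi :: "'p correlation \<Rightarrow> 'p labeled_graph comb" where
  "psi w = (\<Sum>G\<in>Y_loop (nat (- euler_char w)) (genus w).
              \<Sum>H\<in>labeled_versions (root_arg w) (leaf_args w) G. basis H)"


section \<open>The sums above range over finite sets\<close>

lemma finite_Y: "finite (Y n)"
proof (induction n rule: less_induct)
  case (less n)
  have "Y n \<subseteq> insert Edge (\<Union>i<n. \<Union>j<n. (\<lambda>(l, r). l \<triangledown> r) ` (Y i \<times> Y j))"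
  proof
    fix t assume "t \<in> Y n"
    then show "t \<in> insert Edge (\<Union>i<n. \<Union>j<n. (\<lambda>(l, r). l \<triangledown> r) ` (Y i \<times> Y j))"
      by (cases t) (force simp: Y_def)+
  qed
  moreover have "finite (insert Edge (\<Union>i<n. \<Union>j<n. (\<lambda>(l, r). l \<triangledown> r) ` (Y i \<times> Y j)))"
    using less by auto
  ultimately show ?case by (rule finite_subset)
qed

lemma finite_Y_loop: "finite (Y_loop n g)"
proof (rule finite_subset)
  show "Y_loop n g \<subseteq> Y n \<times> Pow {{i, i + 1} |i. i < n}"
    by (auto simp: Y_loop_def)
  show "finite (Y n \<times> Pow {{i, i + 1} |i. i < n})"
    by (simp add: finite_Y)
qed

lemma finite_labeled_versions: "finite (labeled_versions p ps G)"
proof (rule finite_subset)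
  show "labeled_versions p ps G \<subseteq> (\<lambda>l. (G, p, l)) ` (free_leaves G \<rightarrow>\<^sub>E set ps)"
    by (auto simp: labeled_versions_def PiE_def bij_betw_def)
  show "finite ((\<lambda>l. (G, p, l)) ` (free_leaves G \<rightarrow>\<^sub>E set ps))"
    by (intro finite_imageI finite_PiE) (simp_all add: free_leaves_def)
qed

text \<open>Successive connections produce exactly the sets of \<open>g\<close> pairwise disjoint pairs of
  adjacent leaves.\<close>

lemma loop_graphs_from_eq: "loop_graphs_from g t = {G \<in> Y_loop (order t) g. fst G = t}"
proof -
  define E where "E = (\<lambda>i. {i, i + 1}) ` {..<order t}"
  have E: "{{i, i + 1} |i. i < order t} = E"
    unfolding E_def by blast
  have fin: "finite P" if "P \<subseteq> E" for P
    using that by (rule finite_subset) (simp add: E_def)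
  have Y_eq: "{G \<in> Y_loop (order t) g. fst G = t} =
      {(t, P) |P. P \<subseteq> E \<and> disjoint P \<and> card P = g}" for g
    unfolding Y_loop_def E by (auto simp: Y_def)
  have "loop_graphs_from g t = {(t, P) |P. P \<subseteq> E \<and> disjoint P \<and> card P = g}"
  proof (induction g)
    case 0
    have "P \<subseteq> E \<and> disjoint P \<and> card P = 0 \<longleftrightarrow> P = {}" for P
      using fin[of P] by (auto simp: disjoint_def)
    then show ?case by simp
  next
    case (Suc g)
    show ?case
    proof (intro equalityI subsetI)
      fix H assume "H \<in> loop_graphs_from (Suc g) t"
      then obtain G i where G: "G \<in> loop_graphs_from g t"
        and H: "H \<in> Poly_Mapping.keys (connect i G)"
        by auto
      from G obtain P where P: "G = (t, P)" "P \<subseteq> E" "disjoint P" "card P = g"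
        unfolding Suc by blast
      have fr: "{i, i + 1} \<subseteq> free_leaves G" and H': "H = (t, insert {i, i + 1} P)"
        using H P(1) by (simp_all add: connect_def split: if_splits)
      have dj: "{i, i + 1} \<inter> \<Union>P = {}" and "i < order t"
        using fr P(1) unfolding free_leaves_def by auto
      then have "{i, i + 1} \<in> E" by (simp add: E_def)
      moreover have "{i, i + 1} \<notin> P" using dj by blast
      moreover have "disjoint (insert {i, i + 1} P)"
        using P(3) dj unfolding disjoint_def by blast
      ultimately show "H \<in> {(t, P) |P. P \<subseteq> E \<and> disjoint P \<and> card P = Suc g}"
        using P H' fin[of P] by simp
    next
      fix H assume "H \<in> {(t, P) |P. P \<subseteq> E \<and> disjoint P \<and> card P = Suc g}"
      then obtain P where P: "H = (t, P)" "P \<subseteq> E" "disjoint P" "card P = Suc g"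
        by blast
      from P(4) obtain e where e: "e \<in> P" by fastforce
      then obtain i where i: "e = {i, i + 1}" "i < order t"
        using P(2) unfolding E_def by blast
      let ?G = "(t, P - {e})"
      have "disjoint (P - {e})" using P(3) unfolding disjoint_def by blast
      moreover have "card (P - {e}) = g" using P(4) e fin[OF P(2)] by simp
      ultimately have G: "?G \<in> loop_graphs_from g t"
        unfolding Suc using P(2) by blast
      have "e \<inter> \<Union>(P - {e}) = {}" using P(3) e unfolding disjoint_def by blast
      then have fr: "e \<subseteq> free_leaves ?G" using i unfolding free_leaves_def by auto
      have "insert e (P - {e}) = P" using e by blast
      then have "connect i ?G = basis H"
        unfolding connect_def i(1)[symmetric] using fr P(1) by simp
      then have "H \<in> Poly_Mapping.keys (connect i ?G)" by simp
      then show "H \<in> loop_graphs_from (Suc g) t"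
        unfolding loop_graphs_from.simps using G by blast
    qed
  qed
  then show ?thesis by (simp only: Y_eq)
qed

end

theory Submission
  imports Defs
begin

text \<open>Multiplying a tree \<open>t\<close> by \<open>(1)\<close> on the right gives the sum of all trees from which the
  rightmost vertex can be removed to yield \<open>t\<close>. Every tree of order \<open>n + 1\<close> has exactly one
  rightmost vertex, so the \<open>n\<close>-fold product of \<open>(1)\<close> contains every tree of order \<open>n\<close> with
  coefficient one. Connecting leaves and labeling then produces every graph exactly once.\<close>

lemma scale_add: "scale (c + d) x = scale c x + scale d x"
  unfolding scale_def
  by (rule poly_mapping_eqI)
    (simp add: Poly_Mapping.map.rep_eq lookup_add when_def distrib_right)

lemma scale_zero [simp]: "scale 0 x = 0"
  unfolding scale_def
  by (rule poly_mapping_eqI) (simp add: Poly_Mapping.map.rep_eq when_def)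

text \<open>Cancellation can make the support of a sum smaller than the union of the supports. A
  common index set lets additivity be checked termwise.\<close>

lemma lin_ext_superset:
  assumes "finite A" and "Poly_Mapping.keys x \<subseteq> A"
  shows "lin_ext f x = (\<Sum>a\<in>A. scale (Poly_Mapping.lookup x a) (f a))"
  unfolding lin_ext_def using assms
  by (intro sum.mono_neutral_left) (auto simp: in_keys_iff)

lemma lin_ext_zero [simp]: "lin_ext f 0 = 0"
  by (simp add: lin_ext_def)

lemma lin_ext_add: "lin_ext f (x + y) = lin_ext f x + lin_ext f y"
proof -
  let ?A = "Poly_Mapping.keys x \<union> Poly_Mapping.keys y"
  have "Poly_Mapping.keys (x + y) \<subseteq> ?A" by (rule Poly_Mapping.keys_add)
  then show ?thesis
    by (simp add: lin_ext_superset[where A = ?A] lookup_add scale_add sum.distrib)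
qed

lemma lin_ext_sum: "lin_ext f (\<Sum>i\<in>A. x i) = (\<Sum>i\<in>A. lin_ext f (x i))"
  by (induction A rule: infinite_finite_induct) (simp_all add: lin_ext_add)

fun remove_rightmost :: "pbt \<Rightarrow> pbt" where
  "remove_rightmost Edge = Edge"
| "remove_rightmost (l \<triangledown> Edge) = l"
| "remove_rightmost (l \<triangledown> r) = l \<triangledown> remove_rightmost r"

lemma order_remove_rightmost: "order (remove_rightmost t) = order t - 1"
  by (induction t rule: remove_rightmost.induct) auto

text \<open>The two cases for a graft mirror the two terms of its product with
  \<open>corolla\<close>: a new root with right branch \<open>Edge\<close>, or a vertex added inside
  the right branch.\<close>

fun add_rightmost :: "pbt \<Rightarrow> pbt set" where
  "add_rightmost Edge = {corolla}"
| "add_rightmost (l \<triangledown> r) = insert ((l \<triangledown> r) \<triangledown> Edge) ((\<triangledown>) l ` add_rightmost r)"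

lemma finite_add_rightmost: "finite (add_rightmost t)"
  by (induction t) auto

text \<open>\<open>Edge\<close> is excluded because \<open>remove_rightmost Edge = Edge\<close> is
  only a default value: there is no vertex to remove.\<close>

lemma mem_add_rightmost_iff:
  "u \<in> add_rightmost t \<longleftrightarrow> u \<noteq> Edge \<and> remove_rightmost u = t"
proof (induction u arbitrary: t rule: remove_rightmost.induct)
  case 1
  then show ?case by (cases t) (auto simp: corolla_def)
next
  case (2 l)
  have "Edge \<notin> add_rightmost r" for r by (cases r) (auto simp: corolla_def)
  then show ?case by (cases t) (auto simp: corolla_def)
next
  case (3 l v w)
  then show ?case by (cases t) (auto simp: corolla_def)
qed

lemma lr_tree_corolla: "lr_tree t corolla = (\<Sum>u\<in>add_rightmost t. basis u)"
proof (induction t)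
  case Edge
  then show ?case by (simp add: corolla_def)
next
  case (Graft l r)
  \<comment> \<open>The two terms of the product share no tree, since a common one would put
    \<open>Edge\<close> into \<open>add_rightmost r\<close>. With injectivity of grafting this keeps
    every coefficient equal to one.\<close>
  have "(l \<triangledown> r) \<triangledown> Edge \<notin> (\<triangledown>) l ` add_rightmost r"
    using mem_add_rightmost_iff[of Edge r] by auto
  moreover have "inj_on ((\<triangledown>) l) (add_rightmost r)" by (auto intro: inj_onI)
  ultimately show ?case
    using Graft.IH(2)
    by (simp add: corolla_def lin_ext_sum sum.reindex finite_add_rightmost add.commute)
qed

lemma lr_power_corolla: "lr_power (basis corolla) n = (\<Sum>t\<in>Y n. basis t)"
proof (induction n)
  case 0
  have "order t = 0 \<longleftrightarrow> t = Edge" for t by (cases t) auto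
  then have "Y 0 = {Edge}" by (auto simp: Y_def)
  then show ?case by simp
next
  case (Suc n)
  have fibre: "add_rightmost t = {u \<in> Y (Suc n). remove_rightmost u = t}" if "t \<in> Y n" for t
  proof -
    \<comment> \<open>The subtraction in \<open>order u - 1 = n\<close> is truncated; it gives
      \<open>order u = Suc n\<close> because \<open>u\<close> has a vertex.\<close>
    have "u \<in> Y (Suc n)" if "u \<noteq> Edge" "remove_rightmost u = t" for u
      using that \<open>t \<in> Y n\<close> order_remove_rightmost[of u] by (cases u) (auto simp: Y_def)
    then show ?thesis by (auto simp: mem_add_rightmost_iff) (simp add: Y_def)
  qed
  have "lr_power (basis corolla) (Suc n) = (\<Sum>t\<in>Y n. lr_tree t corolla)"
    by (simp add: Suc lr_prod_def lin_ext_sum)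
  also have "\<dots> = (\<Sum>t\<in>Y n. \<Sum>u | u \<in> Y (Suc n) \<and> remove_rightmost u = t. basis u)"
    by (simp add: lr_tree_corolla fibre)
  also have "\<dots> = (\<Sum>u\<in>Y (Suc n). basis u)"
    by (rule sum.group[OF finite_Y finite_Y]) (auto simp: Y_def order_remove_rightmost)
  finally show ?case .
qed

text \<open>A loop graph keeps its tree as first component, so different trees yield different
  graphs and the fibres of \<open>fst\<close> partition \<open>Y_loop n g\<close>.\<close>

lemma add_loops_Y: "add_loops g (\<Sum>t\<in>Y n. basis t) = (\<Sum>G\<in>Y_loop n g. basis G)"
proof -
  have "add_loops g (\<Sum>t\<in>Y n. basis t) = (\<Sum>t\<in>Y n. \<Sum>G\<in>loop_graphs_from g t. basis G)"
    by (simp add: add_loops_def lin_ext_sum)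
  also have "\<dots> = (\<Sum>t\<in>Y n. \<Sum>G | G \<in> Y_loop n g \<and> fst G = t. basis G)"
    by (intro sum.cong refl) (simp add: loop_graphs_from_eq Y_def)
  also have "\<dots> = (\<Sum>G\<in>Y_loop n g. basis G)"
    by (rule sum.group) (auto simp: finite_Y finite_Y_loop Y_loop_def)
  finally show ?thesis .
qed

theorem theorem3:
  fixes g n k :: nat and p :: 'p and ps :: "'p list"
  assumes "g \<ge> 1" and "n \<ge> 1"
    and "int k = 2 - 2 * int g + int n" and "k > 0"
    and "length ps = k - 1" and "distinct (p # ps)"
  shows "psi (W g p ps) =
    sum_over_labels p ps (add_loops g (lr_power (basis corolla) n))"
proof -
  \<comment> \<open>As \<open>k > 0\<close>, \<open>length ps + 1 = k\<close> holds exactly, so the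
    Euler characteristic is \<open>2 - 2g - k = -n\<close>.\<close>
  have "nat (- euler_char (W g p ps)) = n"
    using assms(3-5) by (simp add: euler_char_def)
  then show ?thesis
    by (simp add: psi_def lr_power_corolla add_loops_Y sum_over_labels_def lin_ext_sum)
qed

end
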